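(* Let $F$ be a forest. Then $\mathsf{TS}_3(F)$ is a forest if and only if $F$ is $\{2K_2+K_1,\ D_{2,2,2}+K_1,\ D_{2,4,2}\}$-free.
   Context: Graphs are finite, simple and undirected; a forest is a graph with no cycles (a graph with no nodes counts as a forest). For a graph $G$ and an integer $k\ge 2$, $\mathsf{TS}_k(G)$ is the graph whose nodes are all size-$k$ independent sets of $G$, two nodes $I,J$ being adjacent if there are vertices $u,v$ of $G$ with $I\setminus J=\{u\}$, $J\setminus I=\{v\}$ and $uv\in E(G)$. $+$ denotes disjoint union and $2K_2$ is the disjoint union of two copies of $K_2$. For integers $n,r,s\ge 1$, $D_{r,n,s}$ is the tree obtained from the path $P_n$ on $n$ vertices by attaching $r$ leaves to one end vertex and $s$ leaves to the other end vertex. A graph is $\mathcal{F}$-free if it contains no member of $\mathcal{F}$ as an induced subgraph (up to isomorphism). *)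

theory Defs
  imports "Graph_Theory.Graph_Theory"
begin

text \<open>
  A finite simple undirected graph is a \<^locale>\<open>pair_graph\<close>: a finite vertex set \<^const>\<open>pverts\<close> and an
  irreflexive symmetric adjacency relation \<^const>\<open>parcs\<close> on it.

  The library's \<^const>\<open>forest\<close> is not the undirected notion: in a symmetric digraph every edge yields
  a directed cycle of length 2, so an undirected cycle is a library cycle with at least 3 arcs.
\<close>

definition undirected_forest :: "'a pair_pre_digraph \<Rightarrow> bool" where
  "undirected_forest G \<longleftrightarrow>
     pair_graph G \<and> \<not> (\<exists>p. pre_digraph.cycle (with_proj G) p \<and> 3 \<le> length p)"

definition independent_set :: "'a pair_pre_digraph \<Rightarrow> 'a set \<Rightarrow> bool" where
  "independent_set G I \<longleftrightarrow> I \<subseteq> pverts G \<and> (\<forall>u\<in>I. \<forall>v\<in>I. (u, v) \<notin> parcs G)"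

definition TS :: "nat \<Rightarrow> 'a pair_pre_digraph \<Rightarrow> 'a set pair_pre_digraph" where
  "TS k G =
     (let N = {I. independent_set G I \<and> card I = k}
      in \<lparr> pverts = N,
           parcs = {(I, J). I \<in> N \<and> J \<in> N \<and>
                      (\<exists>u v. I - J = {u} \<and> J - I = {v} \<and> (u, v) \<in> parcs G)} \<rparr>)"

definition complete_graph :: "nat \<Rightarrow> nat pair_pre_digraph" where
  "complete_graph n = \<lparr> pverts = {..<n}, parcs = {(i, j). i < n \<and> j < n \<and> i \<noteq> j} \<rparr>"

definition graph_sum ::
    "'a pair_pre_digraph \<Rightarrow> 'b pair_pre_digraph \<Rightarrow> ('a + 'b) pair_pre_digraph"
    (infixl \<open>\<oplus>\<^sub>g\<close> 65) where
  "G \<oplus>\<^sub>g H =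
     \<lparr> pverts = pverts G <+> pverts H,
       parcs = map_prod Inl Inl ` parcs G \<union> map_prod Inr Inr ` parcs H \<rparr>"

text \<open>
  The path is \<open>0, \<dots>, n - 1\<close>; the next \<open>r\<close> numbers are the leaves attached to \<open>0\<close>, and the last
  \<open>s\<close> numbers are the leaves attached to \<open>n - 1\<close>. Meaningful for \<open>n \<ge> 1\<close>.
\<close>

definition double_broom :: "nat \<Rightarrow> nat \<Rightarrow> nat \<Rightarrow> nat pair_pre_digraph" where
  "double_broom r n s =
     (let E = {(i, Suc i) | i. Suc i < n}
            \<union> {(0, j) | j. n \<le> j \<and> j < n + r}
            \<union> {(n - 1, j) | j. n + r \<le> j \<and> j < n + r + s}
      in \<lparr> pverts = {..<n + r + s}, parcs = E \<union> E\<inverse> \<rparr>)"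

definition induced_free :: "'a pair_pre_digraph \<Rightarrow> 'b pair_pre_digraph \<Rightarrow> bool" where
  "induced_free G H \<longleftrightarrow>
     \<not> (\<exists>G'. induced_subgraph G' (with_proj G) \<and> digraph_iso (with_proj H) G')"

lemma pair_graphI:
  assumes "finite (pverts G)"
    and "\<And>u v. (u, v) \<in> parcs G \<Longrightarrow> u \<in> pverts G \<and> v \<in> pverts G \<and> u \<noteq> v \<and> (v, u) \<in> parcs G"
  shows "pair_graph G"
proof -
  have "finite (parcs G)"
    by (rule finite_subset[of _ "pverts G \<times> pverts G"]) (use assms in auto)
  then show ?thesis
    using assms by unfold_locales (auto simp: symmetric_def sym_def)
qed

lemma pair_graphD:
  assumes "pair_graph G" "(u, v) \<in> parcs G"
  shows "u \<in> pverts G" "v \<in> pverts G" "u \<noteq> v" "(v, u) \<in> parcs G"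
proof -
  interpret pair_graph G by fact
  show "u \<in> pverts G" "v \<in> pverts G" using assms(2) wellformed' by auto
  show "u \<noteq> v" using assms(2) pair_no_loops by fastforce
  show "(v, u) \<in> parcs G" using assms(2) pair_sym_arcs by (simp add: symmetric_def sym_def)
qed

lemma pair_graph_TS:
  assumes "pair_graph G"
  shows "pair_graph (TS k G)"
proof (rule pair_graphI)
  interpret pair_graph G by fact
  have "pverts (TS k G) \<subseteq> Pow (pverts G)"
    by (auto simp: TS_def independent_set_def)
  then show "finite (pverts (TS k G))"
    using pair_finite_verts by (meson finite_Pow_iff finite_subset)
next
  fix I J assume IJ: "(I, J) \<in> parcs (TS k G)"
  then obtain u v where "I - J = {u}" "J - I = {v}" "(u, v) \<in> parcs G"
    by (auto simp: TS_def Let_def)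
  moreover from this have "(v, u) \<in> parcs G" "I \<noteq> J"
    using pair_graphD(4)[OF assms] by auto
  ultimately show "I \<in> pverts (TS k G) \<and> J \<in> pverts (TS k G) \<and> I \<noteq> J \<and> (J, I) \<in> parcs (TS k G)"
    using IJ by (simp add: TS_def Let_def)
qed

lemma pair_graph_complete_graph: "pair_graph (complete_graph n)"
  by (rule pair_graphI) (auto simp: complete_graph_def)

lemma pair_graph_graph_sum:
  assumes "pair_graph G" "pair_graph H"
  shows "pair_graph (G \<oplus>\<^sub>g H)"
proof (rule pair_graphI)
  interpret G: pair_graph G by fact
  interpret H: pair_graph H by fact
  show "finite (pverts (G \<oplus>\<^sub>g H))"
    by (simp add: graph_sum_def G.pair_finite_verts H.pair_finite_verts)
next
  fix u v assume "(u, v) \<in> parcs (G \<oplus>\<^sub>g H)"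
  then show "u \<in> pverts (G \<oplus>\<^sub>g H) \<and> v \<in> pverts (G \<oplus>\<^sub>g H) \<and> u \<noteq> v \<and> (v, u) \<in> parcs (G \<oplus>\<^sub>g H)"
  proof (unfold graph_sum_def pair_pre_digraph.simps, elim UnE imageE)
    fix e assume "(u, v) = map_prod Inl Inl e" "e \<in> parcs G"
    then show "u \<in> pverts G <+> pverts H \<and> v \<in> pverts G <+> pverts H \<and> u \<noteq> v \<and>
        (v, u) \<in> map_prod Inl Inl ` parcs G \<union> map_prod Inr Inr ` parcs H"
      by (cases e) (auto dest: pair_graphD[OF assms(1)])
  next
    fix e assume "(u, v) = map_prod Inr Inr e" "e \<in> parcs H"
    then show "u \<in> pverts G <+> pverts H \<and> v \<in> pverts G <+> pverts H \<and> u \<noteq> v \<and>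
        (v, u) \<in> map_prod Inl Inl ` parcs G \<union> map_prod Inr Inr ` parcs H"
      by (cases e) (auto dest: pair_graphD[OF assms(2)])
  qed
qed

lemma pair_graph_double_broom:
  assumes "n \<ge> 1"
  shows "pair_graph (double_broom r n s)"
  by (rule pair_graphI) (use assms in \<open>auto simp: double_broom_def Let_def\<close>)

lemma induced_free_iff:
  assumes G: "pair_graph G" and H: "pair_graph H"
  shows "induced_free G H \<longleftrightarrow>
    \<not> (\<exists>f. inj_on f (pverts H) \<and> f ` pverts H \<subseteq> pverts G \<and>
         (\<forall>u\<in>pverts H. \<forall>v\<in>pverts H. (u, v) \<in> parcs H \<longleftrightarrow> (f u, f v) \<in> parcs G))"
    (is "_ \<longleftrightarrow> \<not> (\<exists>f. ?emb f)")
proof -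
  interpret G: pair_graph G by fact
  interpret H: pair_graph H by fact
  have "(\<exists>G'. induced_subgraph G' (with_proj G) \<and> digraph_iso (with_proj H) G') \<longleftrightarrow> (\<exists>f. ?emb f)"
  proof
    assume "\<exists>G'. induced_subgraph G' (with_proj G) \<and> digraph_iso (with_proj H) G'"
    then obtain h where
      ind: "induced_subgraph (app_iso h (with_proj H)) (with_proj G)" and
      iso: "pre_digraph.digraph_isomorphism (with_proj H) h"
      unfolding digraph_iso_def by blast
    have comp: "iso_tail h = fst" "iso_head h = snd"
      using ind by (auto simp: induced_subgraph_def subgraph_def compatible_def)
    have arc: "iso_arcs h (u, v) = (iso_verts h u, iso_verts h v)" if "(u, v) \<in> parcs H" for u v
    proof -
      have "\<forall>a\<in>parcs H. iso_verts h (fst a) = fst (iso_arcs h a) \<and>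
          iso_verts h (snd a) = snd (iso_arcs h a)"
        using iso comp by (simp add: pre_digraph.digraph_isomorphism_def)
      from bspec[OF this that] show ?thesis by (simp add: prod_eq_iff)
    qed
    have inj: "inj_on (iso_verts h) (pverts H)"
      using iso unfolding pre_digraph.digraph_isomorphism_def by simp
    have sub: "iso_verts h ` pverts H \<subseteq> pverts G"
      using ind by (auto simp: induced_subgraph_def subgraph_def)
    have arcs: "iso_arcs h ` parcs H =
        {e \<in> parcs G. fst e \<in> iso_verts h ` pverts H \<and> snd e \<in> iso_verts h ` pverts H}"
      using ind by (simp add: induced_subgraph_def)
    have "(u, v) \<in> parcs H \<longleftrightarrow> (iso_verts h u, iso_verts h v) \<in> parcs G"
      if uv: "u \<in> pverts H" "v \<in> pverts H" for u v
    proof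
      assume "(u, v) \<in> parcs H"
      then have "(iso_verts h u, iso_verts h v) \<in> iso_arcs h ` parcs H"
        using arc by (metis imageI)
      then show "(iso_verts h u, iso_verts h v) \<in> parcs G" using arcs by auto
    next
      assume "(iso_verts h u, iso_verts h v) \<in> parcs G"
      then have "(iso_verts h u, iso_verts h v) \<in> iso_arcs h ` parcs H" using uv arcs by auto
      then obtain x y where xy: "(x, y) \<in> parcs H"
        "iso_arcs h (x, y) = (iso_verts h u, iso_verts h v)" by auto
      with arc have "iso_verts h x = iso_verts h u" "iso_verts h y = iso_verts h v" by auto
      with inj uv H.wellformed'[OF xy(1)] have "x = u" "y = v" by (auto dest: inj_onD)
      with xy show "(u, v) \<in> parcs H" by simp
    qed
    with inj sub show "\<exists>f. ?emb f" by blast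
  next
    assume "\<exists>f. ?emb f"
    then obtain f where inj: "inj_on f (pverts H)" and sub: "f ` pverts H \<subseteq> pverts G" and
      adj: "\<And>u v. u \<in> pverts H \<Longrightarrow> v \<in> pverts H \<Longrightarrow> (u, v) \<in> parcs H \<longleftrightarrow> (f u, f v) \<in> parcs G"
      by blast
    define h where
      "h = \<lparr> iso_verts = f, iso_arcs = map_prod f f, iso_head = snd, iso_tail = fst \<rparr>"
    have "inj_on (map_prod f f) (parcs H)"
      by (rule inj_on_subset[OF map_prod_inj_on[OF inj inj]]) (auto dest: H.wellformed')
    then have iso: "pre_digraph.digraph_isomorphism (with_proj H) h"
      using inj H.wf_digraph_axioms by (simp add: pre_digraph.digraph_isomorphism_def h_def)
    have "map_prod f f ` parcs H =
        {e \<in> parcs G. fst e \<in> f ` pverts H \<and> snd e \<in> f ` pverts H}" (is "?L = ?R")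
    proof
      show "?L \<subseteq> ?R" using adj by (auto dest: H.wellformed')
      show "?R \<subseteq> ?L"
      proof
        fix e assume "e \<in> ?R"
        then obtain u v where "u \<in> pverts H" "v \<in> pverts H" "e = (f u, f v)" "e \<in> parcs G"
          by (cases e) auto
        with adj have "(u, v) \<in> parcs H" "e = map_prod f f (u, v)" by auto
        then show "e \<in> ?L" by blast
      qed
    qed
    then have "app_iso h (with_proj H) = with_proj G \<restriction> (f ` pverts H)"
      by (simp add: app_iso_def h_def induce_subgraph_def)
    moreover have "induced_subgraph (with_proj G \<restriction> (f ` pverts H)) (with_proj G)"
      by (rule G.induced_induce) (use sub in simp)
    ultimately show "\<exists>G'. induced_subgraph G' (with_proj G) \<and> digraph_iso (with_proj H) G'"
      using iso unfolding digraph_iso_def by metis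
  qed
  then show ?thesis unfolding induced_free_def by simp
qed

end

(* A graph contains a cycle iff it carries an infinite walk that never backtracks. Given such a walk
   in TS_3(F), look at two consecutive moves. If they use different tokens, first x -> y and then
   p -> d, then d must be adjacent to x: otherwise the two edges commute and, with the resting
   token, induce 2K_2 + K_1. So every move either continues the previous one with the same token
   (a slide) or follows it along a path p - d - x - y. Three moves of one token force the other two
   tokens to have equal neighbourhoods, so they stay frozen and the first token walks forever in a
   forest. Two consecutive follows spread the tokens over an induced P_6, and the next moves are
   forced until D_{2,4,2} appears. Hence slides and follows alternate, and slide-follow-slide
   exhibits D_{2,2,2} + K_1. *)

theory Submission
  imports Defs
begin

section \<open>Non-backtracking walks in forests\<close>

lemma pcas_map_upt:
  "pcas (w i) (map (\<lambda>k. (w k, w (Suc k))) [i..<i + d]) (w (i + d))"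
  by (induction d arbitrary: i) (simp_all add: upt_conv_Cons del: upt_Suc, metis add_Suc)

text \<open>Take a repetition \<open>w i = w (i + d)\<close> with \<open>d\<close> least.
  Irreflexivity excludes \<open>d = 1\<close>, the absence of backtracking excludes
  \<open>d = 2\<close>, and minimality makes the segment simple, so its arcs form a cycle with at
  least 3 arcs.\<close>

lemma forest_walk_inj:
  assumes G: "undirected_forest G"
    and step: "\<And>k. k < n \<Longrightarrow> (w k, w (Suc k)) \<in> parcs G"
    and nb: "\<And>k. Suc k < n \<Longrightarrow> w k \<noteq> w (Suc (Suc k))"
  shows "inj_on w {..n}"
proof (rule ccontr)
  have pg: "pair_graph G" using G by (simp add: undirected_forest_def)
  interpret pair_graph G by fact
  define P where "P d \<longleftrightarrow> d > 0 \<and> (\<exists>i. i + d \<le> n \<and> w i = w (i + d))" for d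
  assume "\<not> inj_on w {..n}"
  then obtain a b where "a < b" "b \<le> n" "w a = w b"
    unfolding inj_on_def by (metis atMost_iff linorder_neqE_nat)
  then have "P (b - a)" unfolding P_def by (intro conjI exI[of _ a]) auto
  then obtain d where "P d" and least: "\<And>e. e < d \<Longrightarrow> \<not> P e"
    by (metis exists_least_iff)
  then obtain i where d: "d > 0" "i + d \<le> n" "w i = w (i + d)" unfolding P_def by blast
  have "d \<noteq> 1" using step[of i] d pair_graphD(3)[OF pg, of "w i" "w (Suc i)"] by auto
  moreover have "d \<noteq> 2" using nb[of i] d by auto
  ultimately have "d \<ge> 3" using d by linarith
  have inj: "inj_on w {Suc i..<Suc (i + d)}"
  proof (rule ccontr)
    assume "\<not> inj_on w {Suc i..<Suc (i + d)}"
    then obtain a b where "a < b" "Suc i \<le> a" "b \<le> i + d" "w a = w b"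
      unfolding inj_on_def by (metis atLeastLessThan_iff less_Suc_eq_le linorder_neqE_nat)
    then have "P (b - a)" "b - a < d"
      using d unfolding P_def by (auto intro!: exI[of _ a])
    with least show False by blast
  qed
  let ?p = "map (\<lambda>k. (w k, w (Suc k))) [i..<i + d]"
  have cas: "pcas (w i) ?p (w i)" using pcas_map_upt[of w i d] d by simp
  have "tl (pawalk_verts (w i) ?p) = map w [Suc i..<Suc (i + d)]"
    using awalk_verts_conv'[of "w i" ?p "w i"] cas d
    by (simp add: comp_def map_Suc_upt[symmetric] del: upt_Suc)
  then have "distinct (tl (pawalk_verts (w i) ?p))"
    using inj by (simp add: distinct_map del: upt_Suc)
  moreover have "awalk (w i) ?p (w i)"
    using cas step d pair_graphD(1)[OF pg step[of i]] by (auto simp: awalk_def)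
  ultimately have "cycle ?p" using d by (auto simp: cycle_def)
  moreover have "length ?p \<ge> 3" using \<open>d \<ge> 3\<close> by simp
  ultimately show False using G unfolding undirected_forest_def by blast
qed

text \<open>In a forest such a walk would be injective on its first
  \<open>card (pverts G) + 1\<close> positions, which are too many. Conversely, a cycle can be run
  around forever.\<close>

lemma undirected_forest_iff_no_walk:
  assumes pg: "pair_graph G"
  shows "undirected_forest G \<longleftrightarrow>
    \<not> (\<exists>w. (\<forall>i. (w i, w (Suc i)) \<in> parcs G) \<and> (\<forall>i. w i \<noteq> w (Suc (Suc i))))"
proof
  assume G: "undirected_forest G"
  show "\<not> (\<exists>w. (\<forall>i. (w i, w (Suc i)) \<in> parcs G) \<and> (\<forall>i. w i \<noteq> w (Suc (Suc i))))"
  proof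
    assume "\<exists>w. (\<forall>i. (w i, w (Suc i)) \<in> parcs G) \<and> (\<forall>i. w i \<noteq> w (Suc (Suc i)))"
    then obtain w where w: "\<And>i. (w i, w (Suc i)) \<in> parcs G" "\<And>i. w i \<noteq> w (Suc (Suc i))"
      by blast
    interpret pair_graph G by fact
    let ?n = "card (pverts G)"
    have "w ` {..?n} \<subseteq> pverts G" using w(1) pair_graphD(1)[OF pg] by blast
    then have "card (w ` {..?n}) \<le> ?n" by (intro card_mono) simp_all
    moreover have "card (w ` {..?n}) = Suc ?n"
      using card_image[OF forest_walk_inj[where w = w, OF G w]] by simp
    ultimately show False by simp
  qed
next
  assume no: "\<not> (\<exists>w. (\<forall>i. (w i, w (Suc i)) \<in> parcs G) \<and> (\<forall>i. w i \<noteq> w (Suc (Suc i))))"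
  interpret pair_graph G by fact
  have False if cyc: "cycle p" and len: "3 \<le> length p" for p
  proof -
    let ?n = "length p"
    obtain u where aw: "awalk u p u" and dist: "distinct (tl (pawalk_verts u p))"
      using cyc by (auto simp: cycle_def)
    have cas: "pcas u p u" and arcs: "set p \<subseteq> parcs G" using aw by (auto simp: awalk_def)
    have nonempty: "p \<noteq> []" using len by auto
    have verts: "pawalk_verts u p = map fst p @ [snd (last p)]"
      using awalk_verts_conv[of u p] nonempty by simp
    have verts': "pawalk_verts u p = fst (hd p) # map snd p"
      using awalk_verts_conv'[of u p u] cas nonempty by simp
    have "distinct (map snd p)" using dist verts' by simp
    \<comment> \<open>The vertex list is read once by tails and once by heads; comparing entries
      shifts the index by one. The last arc closes up to the first, hence the
      \<open>mod\<close>.\<close>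
    have shift: "snd (p ! k) = fst (p ! (Suc k mod ?n))" if "k < ?n" for k
    proof (cases "Suc k < ?n")
      case True
      have "snd (p ! k) = pawalk_verts u p ! Suc k" using verts' that by simp
      also have "\<dots> = fst (p ! Suc k)" using verts True by (simp add: nth_append)
      finally show ?thesis using True by simp
    next
      case False
      then have "Suc k = ?n" using that by simp
      moreover have "snd (last p) = fst (hd p)"
        using awlast_if_cas[of u p u] awhd_if_cas[of u p u] cas verts verts'
        by (metis last_snoc list.sel(1) awalk_verts_with_proj_eq cas_with_proj_eq)
      ultimately show ?thesis using nonempty
        by (metis diff_Suc_1 hd_conv_nth last_conv_nth mod_self)
    qed
    define w where "w k = snd (p ! (k mod ?n))" for k
    have "(w k, w (Suc k)) \<in> parcs G" for k
    proof -
      have "k mod ?n < ?n" "Suc k mod ?n < ?n" using nonempty by simp_all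
      then have "w k = fst (p ! (Suc k mod ?n))" "p ! (Suc k mod ?n) \<in> parcs G"
        using shift[of "k mod ?n"] arcs by (auto simp: w_def mod_Suc_eq)
      then show ?thesis by (simp add: w_def)
    qed
    moreover have "w k \<noteq> w (Suc (Suc k))" for k
    proof
      assume "w k = w (Suc (Suc k))"
      moreover have "i mod ?n < ?n" for i using nonempty by simp
      ultimately have "k mod ?n = Suc (Suc k) mod ?n"
        using nth_eq_iff_index_eq[OF \<open>distinct (map snd p)\<close>, of "k mod ?n" "Suc (Suc k) mod ?n"]
        by (simp add: w_def)
      moreover have "Suc (Suc k) mod ?n = Suc (Suc (k mod ?n)) mod ?n" by (metis mod_Suc_eq)
      \<comment> \<open>Here length at least 3 is essential: modulo 1 or 2 a shift by two returns to
        the same residue.\<close>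
      moreover have "r \<noteq> Suc (Suc r) mod ?n" if "r < ?n" for r
        using len that by (cases "Suc (Suc r) < ?n") (auto simp: mod_if)
      ultimately show False using \<open>p \<noteq> []\<close> by (metis length_greater_0_conv mod_less_divisor)
    qed
    ultimately show False using no by blast
  qed
  then show "undirected_forest G" using pg unfolding undirected_forest_def by blast
qed

section \<open>Walks given as lists, and their chordlessness in forests\<close>

fun nonbacktracking :: "'a list \<Rightarrow> bool" where
  "nonbacktracking (x # y # z # zs) \<longleftrightarrow> x \<noteq> z \<and> nonbacktracking (y # z # zs)"
| "nonbacktracking _ \<longleftrightarrow> True"

text \<open>For a walk this means that the list is an induced path. Every fact is stored in both
  orders, so that \<open>simp\<close> can use it whichever way round a goal mentions the
  pair.\<close>

fun chordless :: "('a \<times> 'a) set \<Rightarrow> 'a list \<Rightarrow> bool" where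
  "chordless E (x # y # zs) \<longleftrightarrow>
     (\<forall>z\<in>set zs. x \<noteq> z \<and> z \<noteq> x \<and> (x, z) \<notin> E \<and> (z, x) \<notin> E) \<and> chordless E (y # zs)"
| "chordless E _ \<longleftrightarrow> True"

lemma nonbacktracking_nth:
  "nonbacktracking xs \<Longrightarrow> Suc (Suc k) < length xs \<Longrightarrow> xs ! k \<noteq> xs ! Suc (Suc k)"
proof (induction xs arbitrary: k rule: nonbacktracking.induct)
  case (1 x y z zs)
  then show ?case by (cases k) auto
qed auto

text \<open>The walk is injective, which separates its ends. An edge from the last vertex back to
  \<open>x\<close> would extend it to a non-backtracking walk that repeats \<open>x\<close>.\<close>

lemma forest_walk_ends:
  assumes G: "undirected_forest G"
    and walk: "successively (\<lambda>u v. (u, v) \<in> parcs G) (x # xs)" "nonbacktracking (x # xs)"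
    and len: "2 \<le> length xs" and z: "z = last xs"
  shows "x \<noteq> z" "(x, z) \<notin> parcs G" "(z, x) \<notin> parcs G"
proof -
  have pg: "pair_graph G" using G by (simp add: undirected_forest_def)
  \<comment> \<open>The extra \<open>x\<close> at position \<open>?n + 1\<close> is the end of the
    hypothetical closing step.\<close>
  let ?n = "length xs" and ?w = "\<lambda>k. (x # xs @ [x]) ! k"
  have step: "(?w k, ?w (Suc k)) \<in> parcs G" if "k < ?n" for k
    using walk(1) that by (cases k) (auto simp: successively_conv_nth nth_append)
  have nb: "?w k \<noteq> ?w (Suc (Suc k))" if "Suc k < ?n" for k
    using nonbacktracking_nth[OF walk(2), of k] that
    by (simp add: nth_append nth_Cons split: nat.splits)
  have inj: "inj_on ?w {..?n}" by (rule forest_walk_inj[where w = "?w", OF G step nb])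
  have last: "?w ?n = z" using len z by (cases xs rule: rev_cases) auto
  show "x \<noteq> z" using inj_onD[OF inj, of 0 ?n] last len by auto
  have "(z, x) \<notin> parcs G"
  proof
    assume zx: "(z, x) \<in> parcs G"
    have step': "(?w k, ?w (Suc k)) \<in> parcs G" if "k < Suc ?n" for k
      using step[of k] zx last that by (cases "k = ?n") (auto simp: nth_append)
    \<comment> \<open>The only new turn is at \<open>z\<close>. The vertex before it has position at
      least 1 because \<open>2 \<le> length xs\<close>, so injectivity separates it from
      \<open>x\<close>.\<close>
    have nb': "?w k \<noteq> ?w (Suc (Suc k))" if "Suc k < Suc ?n" for k
    proof (cases "Suc k = ?n")
      case True
      then have "?w (Suc (Suc k)) = ?w 0" by (simp add: nth_append)
      moreover have "?w k \<noteq> ?w 0" using inj_onD[OF inj, of k 0] True len by auto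
      ultimately show ?thesis by simp
    qed (use nb that in auto)
    have "inj_on ?w {..Suc ?n}" by (rule forest_walk_inj[where w = "?w", OF G step' nb'])
    moreover have "?w (Suc ?n) = ?w 0" by simp
    ultimately show False using inj_onD[of ?w "{..Suc ?n}" "Suc ?n" 0] by auto
  qed
  then show "(z, x) \<notin> parcs G" "(x, z) \<notin> parcs G" using pair_graphD(4)[OF pg] by auto
qed

lemma nonbacktracking_prefix: "nonbacktracking (xs @ ys) \<Longrightarrow> nonbacktracking xs"
proof (induction xs rule: nonbacktracking.induct)
  case (1 x y z zs)
  then show ?case by simp
qed auto

text \<open>Every contiguous segment is again a non-backtracking walk, so
  \<open>forest_walk_ends\<close> applies to any two entries at distance at least 2.\<close>

lemma forest_chordless:
  assumes G: "undirected_forest G"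
  shows "successively (\<lambda>u v. (u, v) \<in> parcs G) xs \<Longrightarrow> nonbacktracking xs \<Longrightarrow>
    chordless (parcs G) xs"
proof (induction "parcs G" xs rule: chordless.induct)
  case (1 x y zs)
  have "x \<noteq> z \<and> z \<noteq> x \<and> (x, z) \<notin> parcs G \<and> (z, x) \<notin> parcs G" if "z \<in> set zs" for z
  proof -
    from that obtain as bs where zs: "zs = as @ z # bs" by (auto simp: in_set_conv_decomp)
    have "nonbacktracking (x # y # as @ [z])"
      using 1(3) nonbacktracking_prefix[of "x # y # as @ [z]" bs] zs by simp
    moreover have "successively (\<lambda>u v. (u, v) \<in> parcs G) (x # y # as @ [z])"
      using 1(2) successively_append_iff[of "\<lambda>u v. (u, v) \<in> parcs G" "x # y # as @ [z]" bs] zs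
      by simp
    ultimately show ?thesis
      using forest_walk_ends[OF G, of x "y # as @ [z]" z] by auto
  qed
  moreover have "nonbacktracking (y # zs)" using 1(3) by (cases zs) auto
  ultimately show ?case using 1 by simp
qed auto


text \<open>Going around the list forever gives an infinite non-backtracking walk. Appending
  \<open>hd xs\<close> and \<open>take 2 xs\<close> makes the seam explicit: the closing step and
  the two turns next to it are checked like all others, by evaluation on a concrete list.\<close>

lemma closed_walk_not_forest:
  assumes G: "undirected_forest G"
    and walk: "successively (\<lambda>u v. (u, v) \<in> parcs G) (xs @ [hd xs])"
    and nb: "nonbacktracking (xs @ take 2 xs)"
    and len: "2 \<le> length xs"
  shows False
proof -
  have pg: "pair_graph G" using G by (simp add: undirected_forest_def)
  let ?n = "length xs"
  define w where "w k = xs ! (k mod ?n)" for k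
  have n: "?n > 0" using len by linarith
  have "(w k, w (Suc k)) \<in> parcs G" for k
  proof -
    have r: "k mod ?n < ?n" using n by simp
    then have "((xs @ [hd xs]) ! (k mod ?n), (xs @ [hd xs]) ! Suc (k mod ?n)) \<in> parcs G"
      using walk by (simp add: successively_conv_nth)
    moreover have "(xs @ [hd xs]) ! Suc (k mod ?n) = w (Suc k)"
    proof (cases "Suc (k mod ?n) < ?n")
      case False
      then have "Suc (k mod ?n) = ?n" using r by linarith
      then show ?thesis using n by (simp add: w_def nth_append mod_Suc hd_conv_nth)
    qed (simp add: w_def nth_append mod_Suc)
    ultimately show ?thesis using r by (simp add: w_def nth_append)
  qed
  moreover have "w k \<noteq> w (Suc (Suc k))" for k
  proof -
    have r: "k mod ?n < ?n" using n by simp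
    then have "(xs @ take 2 xs) ! (k mod ?n) \<noteq> (xs @ take 2 xs) ! Suc (Suc (k mod ?n))"
      using nonbacktracking_nth[OF nb, of "k mod ?n"] len by simp
    moreover have "(xs @ take 2 xs) ! Suc (Suc m) = xs ! (Suc (Suc m) mod ?n)" if "m < ?n" for m
      using that len by (cases "Suc (Suc m) < ?n") (auto simp: nth_append mod_if)
    note this[OF r]
    moreover have "Suc (Suc (k mod ?n)) mod ?n = Suc (Suc k) mod ?n" by (metis mod_Suc_eq)
    ultimately show ?thesis using r by (simp add: w_def nth_append)
  qed
  ultimately show False using G undirected_forest_iff_no_walk[OF pg] by blast
qed

section \<open>Induced copies of the three forbidden graphs\<close>

text \<open>The embedding sends the \<open>i\<close>-th entry of \<open>hs\<close> to the
  \<open>i\<close>-th entry of \<open>xs\<close>. Each pair is tested in one order only; symmetry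
  and irreflexivity supply the rest.\<close>

lemma not_induced_freeI:
  assumes G: "pair_graph G" and H: "pair_graph H"
    and hs: "pverts H = set hs" "distinct hs" and len: "length xs = length hs"
    and xs: "distinct xs" "set xs \<subseteq> pverts G"
    and arcs: "sorted_wrt (\<lambda>(h, x) (h', x'). (h, h') \<in> parcs H \<longleftrightarrow> (x, x') \<in> parcs G) (zip hs xs)"
  shows "\<not> induced_free G H"
proof -
  define f where "f = the \<circ> map_of (zip hs xs)"
  have "map f hs = xs"
    by (rule nth_equalityI) (use len hs in \<open>simp_all add: f_def map_of_zip_nth\<close>)
  then have "zip hs xs = map (\<lambda>h. (h, f h)) hs"
    using zip_map2[of hs f hs] by (auto simp: zip_same_conv_map)
  then have *: "sorted_wrt (\<lambda>h h'. (h, h') \<in> parcs H \<longleftrightarrow> (f h, f h') \<in> parcs G) hs"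
    using arcs by (simp add: sorted_wrt_map)
  have "(u, v) \<in> parcs H \<longleftrightarrow> (f u, f v) \<in> parcs G" if "u \<in> pverts H" "v \<in> pverts H" for u v
  proof -
    from that hs obtain i j where ij: "i < length hs" "j < length hs" "u = hs ! i" "v = hs ! j"
      by (metis in_set_conv_nth)
    consider "i < j" | "j < i" | "u = v" using ij by (metis linorder_neqE_nat)
    then show ?thesis
      using sorted_wrt_nth_less[OF *, of i j] sorted_wrt_nth_less[OF *, of j i] ij
        pair_graphD(3,4)[OF G] pair_graphD(3,4)[OF H]
      by cases blast+
  qed
  moreover have "inj_on f (pverts H)" "f ` pverts H \<subseteq> pverts G"
    using \<open>map f hs = xs\<close> xs hs by (auto simp: distinct_map)
  ultimately show ?thesis unfolding induced_free_iff[OF G H] by blast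
qed

text \<open>With a concrete \<open>hs\<close> this turns an embedding into named vertices, whose
  relations in \<open>G\<close> are given in both orders for the simplifier.\<close>

lemma not_induced_freeE:
  assumes G: "pair_graph G" and H: "pair_graph H" and "\<not> induced_free G H"
    and hs: "pverts H = set hs" "distinct hs"
  obtains xs where "length xs = length hs" "set xs \<subseteq> pverts G"
    "sorted_wrt (\<lambda>(h, x) (h', x'). x \<noteq> x' \<and> x' \<noteq> x \<and> ((h, h') \<in> parcs H \<longleftrightarrow> (x, x') \<in> parcs G) \<and>
       ((h, h') \<in> parcs H \<longleftrightarrow> (x', x) \<in> parcs G)) (zip hs xs)"
proof -
  from assms(3) obtain f where f: "inj_on f (pverts H)" "f ` pverts H \<subseteq> pverts G"
    and arcs: "\<And>u v. u \<in> pverts H \<Longrightarrow> v \<in> pverts H \<Longrightarrow> (u, v) \<in> parcs H \<longleftrightarrow> (f u, f v) \<in> parcs G"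
    unfolding induced_free_iff[OF G H] by blast
  have sym: "(u, v) \<in> parcs G \<longleftrightarrow> (v, u) \<in> parcs G" for u v
    using pair_graphD(4)[OF G] by blast
  show thesis
  proof (rule that[of "map f hs"])
    show "sorted_wrt (\<lambda>(h, x) (h', x'). x \<noteq> x' \<and> x' \<noteq> x \<and> ((h, h') \<in> parcs H \<longleftrightarrow> (x, x') \<in> parcs G) \<and>
       ((h, h') \<in> parcs H \<longleftrightarrow> (x', x) \<in> parcs G)) (zip hs (map f hs))"
      unfolding sorted_wrt_iff_nth_less
      using arcs hs sym inj_on_eq_iff[OF f(1)] by (auto simp: nth_eq_iff_index_eq)
  qed (use f hs in auto)
qed

lemma pverts_graph_sum: "pverts (G \<oplus>\<^sub>g H) = Inl ` pverts G \<union> Inr ` pverts H"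
  by (auto simp: graph_sum_def)

lemma parcs_graph_sum:
  "(Inl a, Inl b) \<in> parcs (G \<oplus>\<^sub>g H) \<longleftrightarrow> (a, b) \<in> parcs G"
  "(Inr c, Inr d) \<in> parcs (G \<oplus>\<^sub>g H) \<longleftrightarrow> (c, d) \<in> parcs H"
  "(Inl a, Inr d) \<notin> parcs (G \<oplus>\<^sub>g H)" "(Inr c, Inl b) \<notin> parcs (G \<oplus>\<^sub>g H)"
  by (auto simp: graph_sum_def map_prod_def)

text \<open>The list fixes the order in which images are named later: the ends of one edge, the ends
  of the other, the isolated vertex.\<close>

definition verts_2K2_K1 :: "((nat + nat) + nat) list" where
  "verts_2K2_K1 = [Inl (Inl 0), Inl (Inl 1), Inl (Inr 0), Inl (Inr 1), Inr 0]"

text \<open>Order: the spine 0, 1, the leaves 2, 3 at 0, the leaves 4, 5 at 1, the isolated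
  vertex.\<close>

definition verts_D222_K1 :: "(nat + nat) list" where
  "verts_D222_K1 = [Inl 0, Inl 1, Inl 2, Inl 3, Inl 4, Inl 5, Inr 0]"

text \<open>Order: the spine 0 to 3, the leaves 4, 5 at 0, the leaves 6, 7 at 3.\<close>

definition verts_D242 :: "nat list" where
  "verts_D242 = [0, 1, 2, 3, 4, 5, 6, 7]"

lemma lessThan_numerals:
  "{..<Suc 0} = {0::nat}" "{..<2} = {0, 1::nat}" "{..<6} = {0, 1, 2, 3, 4, 5::nat}"
  "{..<8} = {0, 1, 2, 3, 4, 5, 6, 7::nat}"
  by auto

lemma
  shows verts_2K2_K1:
      "pverts (complete_graph 2 \<oplus>\<^sub>g complete_graph 2 \<oplus>\<^sub>g complete_graph 1) = set verts_2K2_K1"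
      "distinct verts_2K2_K1"
    and verts_D222_K1: "pverts (double_broom 2 2 2 \<oplus>\<^sub>g complete_graph 1) = set verts_D222_K1"
      "distinct verts_D222_K1"
    and verts_D242: "pverts (double_broom 2 4 2) = set verts_D242" "distinct verts_D242"
  by (auto simp: pverts_graph_sum complete_graph_def double_broom_def Let_def lessThan_numerals
      verts_2K2_K1_def verts_D222_K1_def verts_D242_def)

lemma arc_complete_graph: "(i, j) \<in> parcs (complete_graph n) \<longleftrightarrow> i < n \<and> j < n \<and> i \<noteq> j"
  by (simp add: complete_graph_def)

lemma arc_double_broom:
  "(i, j) \<in> parcs (double_broom r n s) \<longleftrightarrow>
     i < n \<and> j < n \<and> (j = Suc i \<or> i = Suc j) \<or>
     i = 0 \<and> n \<le> j \<and> j < n + r \<or> j = 0 \<and> n \<le> i \<and> i < n + r \<or>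
     i = n - 1 \<and> n + r \<le> j \<and> j < n + r + s \<or> j = n - 1 \<and> n + r \<le> i \<and> i < n + r + s"
  by (auto simp: double_broom_def Let_def)

lemmas copy_simps = verts_2K2_K1_def verts_D222_K1_def verts_D242_def parcs_graph_sum
  arc_complete_graph arc_double_broom

lemma pair_graph_patterns:
  "pair_graph (complete_graph 2 \<oplus>\<^sub>g complete_graph 2 \<oplus>\<^sub>g complete_graph 1)"
  "pair_graph (double_broom 2 2 2 \<oplus>\<^sub>g complete_graph 1)" "pair_graph (double_broom 2 4 2)"
  by (simp_all add: pair_graph_graph_sum pair_graph_complete_graph pair_graph_double_broom)

section \<open>Sliding three tokens\<close>

lemma TS3_node_iff:
  assumes "pair_graph G"
  shows "{x, y, z} \<in> pverts (TS 3 G) \<longleftrightarrow>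
    distinct [x, y, z] \<and> {x, y, z} \<subseteq> pverts G \<and>
    (x, y) \<notin> parcs G \<and> (x, z) \<notin> parcs G \<and> (y, z) \<notin> parcs G"
proof -
  have "card {x, y, z} = 3 \<longleftrightarrow> distinct [x, y, z]" by (auto simp: card_insert_if)
  then show ?thesis using pair_graphD(3,4)[OF assms]
    by (auto simp: TS_def Let_def independent_set_def)
qed

text \<open>The three forms differ in the place of the moving token in the set expression, so that
  one of them matches each step of an explicit closed walk.\<close>

lemma TS3_slide:
  assumes "pair_graph G" "(x, y) \<in> parcs G" "{x, p, q} \<in> pverts (TS 3 G)"
    "{y, p, q} \<in> pverts (TS 3 G)"
  shows "({x, p, q}, {y, p, q}) \<in> parcs (TS 3 G)" "({p, x, q}, {p, y, q}) \<in> parcs (TS 3 G)"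
    "({p, q, x}, {p, q, y}) \<in> parcs (TS 3 G)"
proof -
  have "distinct [x, p, q]" "distinct [y, p, q]" "x \<noteq> y"
    using assms(3,4) pair_graphD(3)[OF assms(1,2)] unfolding TS3_node_iff[OF assms(1)] by auto
  then have "{x, p, q} - {y, p, q} = {x}" "{y, p, q} - {x, p, q} = {y}" by auto
  then show "({x, p, q}, {y, p, q}) \<in> parcs (TS 3 G)"
    using assms by (auto simp: TS_def Let_def)
  then show "({p, x, q}, {p, y, q}) \<in> parcs (TS 3 G)" "({p, q, x}, {p, q, y}) \<in> parcs (TS 3 G)"
    by (simp_all add: insert_commute)
qed

lemma TS_arcE:
  assumes "(I, J) \<in> parcs (TS k G)"
  obtains u v where "I \<in> pverts (TS k G)" "J \<in> pverts (TS k G)" "u \<in> I" "v \<notin> I"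
    "(u, v) \<in> parcs G" "J = insert v (I - {u})"
proof -
  from assms obtain u v where uv: "I - J = {u}" "J - I = {v}" "(u, v) \<in> parcs G"
    "I \<in> pverts (TS k G)" "J \<in> pverts (TS k G)"
    by (auto simp: TS_def Let_def)
  then have "u \<in> I" "v \<notin> I" "J = insert v (I - {u})" by blast+
  with uv that show thesis by blast
qed

section \<open>Each forbidden subgraph yields a cycle of token triples\<close>

lemma forest_TS3_imp_no_2K2_K1:
  assumes F: "pair_graph F" and TS: "undirected_forest (TS 3 F)"
  shows "induced_free F (complete_graph 2 \<oplus>\<^sub>g complete_graph 2 \<oplus>\<^sub>g complete_graph 1)"
proof (rule ccontr)
  note [simp] = copy_simps
  assume "\<not> ?thesis"
  from not_induced_freeE[OF F pair_graph_patterns(1) this verts_2K2_K1]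
  obtain xs where xs: "length xs = length verts_2K2_K1" "set xs \<subseteq> pverts F"
    "sorted_wrt (\<lambda>(h, x) (h', x'). x \<noteq> x' \<and> x' \<noteq> x \<and>
       ((h, h') \<in> parcs
          (complete_graph 2 \<oplus>\<^sub>g complete_graph 2 \<oplus>\<^sub>g complete_graph 1) \<longleftrightarrow> (x, x') \<in> parcs F) \<and>
       ((h, h') \<in> parcs
          (complete_graph 2 \<oplus>\<^sub>g complete_graph 2 \<oplus>\<^sub>g complete_graph 1) \<longleftrightarrow> (x', x) \<in> parcs F))
       (zip verts_2K2_K1 xs)" by blast
  then obtain a b c d e where "xs = [a, b, c, d, e]"
    by (auto simp: verts_2K2_K1_def length_Suc_conv)
  note f = xs(2-)[unfolded this, simplified]
  show False
  proof (rule closed_walk_not_forest[OF TS])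
    \<comment> \<open>The token on \<open>e\<close> rests, while moves along the edges
      \<open>ab\<close> and \<open>cd\<close> alternate around a 4-cycle.\<close>
    let ?L = "[{a, c, e}, {b, c, e}, {b, d, e}, {a, d, e}]"
    show "successively (\<lambda>u v. (u, v) \<in> parcs (TS 3 F)) (?L @ [hd ?L])"
      unfolding append.simps list.sel successively.simps
      by (intro conjI TrueI TS3_slide F) (use f in \<open>simp_all add: TS3_node_iff[OF F]\<close>)
    show "nonbacktracking (?L @ take 2 ?L)"
      using f by (simp add: set_eq_subset)
  qed simp
qed

lemma forest_TS3_imp_no_D222_K1:
  assumes F: "pair_graph F" and TS: "undirected_forest (TS 3 F)"
  shows "induced_free F (double_broom 2 2 2 \<oplus>\<^sub>g complete_graph 1)"
proof (rule ccontr)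
  note [simp] = copy_simps
  assume "\<not> ?thesis"
  from not_induced_freeE[OF F pair_graph_patterns(2) this verts_D222_K1]
  obtain xs where xs: "length xs = length verts_D222_K1" "set xs \<subseteq> pverts F"
    "sorted_wrt (\<lambda>(h, x) (h', x'). x \<noteq> x' \<and> x' \<noteq> x \<and>
       ((h, h') \<in> parcs (double_broom 2 2 2 \<oplus>\<^sub>g complete_graph 1) \<longleftrightarrow> (x, x') \<in> parcs F) \<and>
       ((h, h') \<in> parcs (double_broom 2 2 2 \<oplus>\<^sub>g complete_graph 1) \<longleftrightarrow> (x', x) \<in> parcs F))
       (zip verts_D222_K1 xs)" by blast
  then obtain a b a1 a2 b1 b2 e where "xs = [a, b, a1, a2, b1, b2, e]"
    by (auto simp: verts_D222_K1_def length_Suc_conv)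
  note f = xs(2-)[unfolded this, simplified]
  show False
  proof (rule closed_walk_not_forest[OF TS])
    \<comment> \<open>With \<open>e\<close> resting, one token goes from \<open>a1\<close> over
      \<open>a\<close> to \<open>a2\<close>, then the other from \<open>b1\<close> over
      \<open>b\<close> to \<open>b2\<close>, then both return in the same order. Each crosses its
      centre while the other is on a leaf.\<close>
    let ?L = "[{a1, b1, e}, {a, b1, e}, {a2, b1, e}, {a2, b, e}, {a2, b2, e}, {a, b2, e},
      {a1, b2, e}, {a1, b, e}]"
    show "successively (\<lambda>u v. (u, v) \<in> parcs (TS 3 F)) (?L @ [hd ?L])"
      unfolding append.simps list.sel successively.simps
      by (intro conjI TrueI TS3_slide F) (use f in \<open>simp_all add: TS3_node_iff[OF F]\<close>)
    show "nonbacktracking (?L @ take 2 ?L)"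
      using f by (simp add: set_eq_subset)
  qed simp
qed

lemma forest_TS3_imp_no_D242:
  assumes F: "pair_graph F" and TS: "undirected_forest (TS 3 F)"
  shows "induced_free F (double_broom 2 4 2)"
proof (rule ccontr)
  note [simp] = copy_simps
  assume "\<not> ?thesis"
  from not_induced_freeE[OF F pair_graph_patterns(3) this verts_D242]
  obtain xs where xs: "length xs = length verts_D242" "set xs \<subseteq> pverts F"
    "sorted_wrt (\<lambda>(h, x) (h', x'). x \<noteq> x' \<and> x' \<noteq> x \<and>
       ((h, h') \<in> parcs (double_broom 2 4 2) \<longleftrightarrow> (x, x') \<in> parcs F) \<and>
       ((h, h') \<in> parcs (double_broom 2 4 2) \<longleftrightarrow> (x', x) \<in> parcs F))
       (zip verts_D242 xs)" by blast
  then obtain a p q b a1 a2 b1 b2 where "xs = [a, p, q, b, a1, a2, b1, b2]"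
    by (auto simp: verts_D242_def length_Suc_conv)
  note f = xs(2-)[unfolded this, simplified]
  show False
  proof (rule closed_walk_not_forest[OF TS])
    \<comment> \<open>The outer tokens change leaves in turn, as for \<open>D_{2,2,2}\<close>. The
      middle token waits on \<open>p\<close> while the token at the \<open>b\<close> end passes
      through \<open>b\<close>, and on \<open>q\<close> while the one at the \<open>a\<close> end
      passes through \<open>a\<close>.\<close>
    let ?L = "[{a1, p, b1}, {a1, p, b}, {a1, p, b2}, {a1, q, b2}, {a, q, b2}, {a2, q, b2},
      {a2, p, b2}, {a2, p, b}, {a2, p, b1}, {a2, q, b1}, {a, q, b1}, {a1, q, b1}]"
    show "successively (\<lambda>u v. (u, v) \<in> parcs (TS 3 F)) (?L @ [hd ?L])"
      unfolding append.simps list.sel successively.simps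
      by (intro conjI TrueI TS3_slide F) (use f in \<open>simp_all add: TS3_node_iff[OF F]\<close>)
    show "nonbacktracking (?L @ take 2 ?L)"
      using f by (simp add: set_eq_subset)
  qed simp
qed

section \<open>The converse: an infinite non-backtracking walk of token triples\<close>

locale sliding_walk =
  fixes F :: "'a pair_pre_digraph" and w :: "nat \<Rightarrow> 'a set"
  assumes forest: "undirected_forest F"
    and w_arc: "\<And>i. (w i, w (Suc i)) \<in> parcs (TS 3 F)"
    and w_nb: "\<And>i. w i \<noteq> w (Suc (Suc i))"
    and free1: "induced_free F (complete_graph 2 \<oplus>\<^sub>g complete_graph 2 \<oplus>\<^sub>g complete_graph 1)"
    and free2: "induced_free F (double_broom 2 2 2 \<oplus>\<^sub>g complete_graph 1)"
    and free3: "induced_free F (double_broom 2 4 2)"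
begin

abbreviation adj (infix "\<sim>" 50) where "u \<sim> v \<equiv> (u, v) \<in> parcs F"

lemma pair_graph_F: "pair_graph F"
  using forest by (simp add: undirected_forest_def)

lemma adj_sym: "u \<sim> v \<longleftrightarrow> v \<sim> u"
  using pair_graphD(4)[OF pair_graph_F] by blast

lemma chordless_walk:
  "successively (\<sim>) xs \<Longrightarrow> nonbacktracking xs \<Longrightarrow> chordless (parcs F) xs"
  by (rule forest_chordless[OF forest])

text \<open>Tokens are anonymous in \<open>w i\<close>; naming the moving and the resting ones lets
  a single token be traced through several moves.\<close>

definition move :: "nat \<Rightarrow> 'a \<Rightarrow> 'a \<Rightarrow> 'a \<Rightarrow> 'a \<Rightarrow> bool" where
  "move i x y p q \<longleftrightarrow> w i = {x, p, q} \<and> w (Suc i) = {y, p, q} \<and> x \<sim> y \<and> distinct [x, y, p, q]"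

lemma move_commute: "move i x y p q \<longleftrightarrow> move i x y q p"
  by (auto simp: move_def insert_commute)

text \<open>The non-adjacencies express the independence of the token sets before and after the
  move.\<close>

lemma moveD:
  assumes "move i x y p q"
  shows "x \<sim> y" "y \<sim> x" "distinct [x, y, p, q]"
    and "\<not> x \<sim> p" "\<not> p \<sim> x" "\<not> x \<sim> q" "\<not> q \<sim> x" "\<not> y \<sim> p" "\<not> p \<sim> y"
    "\<not> y \<sim> q" "\<not> q \<sim> y" "\<not> p \<sim> q" "\<not> q \<sim> p"
    and "{x, y, p, q} \<subseteq> pverts F"
proof -
  have eqs: "w i = {x, p, q}" "w (Suc i) = {y, p, q}" "x \<sim> y" "distinct [x, y, p, q]"
    using assms by (auto simp: move_def)
  have "{x, p, q} \<in> pverts (TS 3 F)" "{y, p, q} \<in> pverts (TS 3 F)"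
    using pair_graphD(1,2)[OF pair_graph_TS[OF pair_graph_F] w_arc[of i]] eqs by simp_all
  then have "{x, y, p, q} \<subseteq> pverts F" "\<not> x \<sim> p" "\<not> x \<sim> q" "\<not> y \<sim> p" "\<not> y \<sim> q" "\<not> p \<sim> q"
    unfolding TS3_node_iff[OF pair_graph_F] by auto
  then show "x \<sim> y" "y \<sim> x" "distinct [x, y, p, q]" "{x, y, p, q} \<subseteq> pverts F"
    "\<not> x \<sim> p" "\<not> p \<sim> x" "\<not> x \<sim> q" "\<not> q \<sim> x" "\<not> y \<sim> p" "\<not> p \<sim> y"
    "\<not> y \<sim> q" "\<not> q \<sim> y" "\<not> p \<sim> q" "\<not> q \<sim> p"
    using eqs(3,4) by (auto simp: adj_sym)
qed

lemma move_sets: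
  assumes "move i x y p q"
  shows "w i = {x, p, q}" "w (Suc i) = {y, p, q}"
  using assms by (auto simp: move_def)

text \<open>Distinctness follows from the adjacencies: identifying two of the vertices would turn an
  assumed edge into an excluded one.\<close>

lemma no_2K2_K1:
  assumes "a \<sim> b" "c \<sim> d" "e \<in> pverts F"
    and "\<not> a \<sim> c" "\<not> a \<sim> d" "\<not> b \<sim> c" "\<not> b \<sim> d"
    and "\<not> e \<sim> a" "\<not> e \<sim> b" "\<not> e \<sim> c" "\<not> e \<sim> d"
  shows False
proof -
  have sym: "b \<sim> a" "d \<sim> c" using assms by (simp_all add: adj_sym)
  have "\<not> induced_free F (complete_graph 2 \<oplus>\<^sub>g complete_graph 2 \<oplus>\<^sub>g complete_graph 1)"
  proof (rule not_induced_freeI[OF pair_graph_F pair_graph_patterns(1) verts_2K2_K1])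
    show "length [a, b, c, d, e] = length verts_2K2_K1" by (simp add: verts_2K2_K1_def)
    show "distinct [a, b, c, d, e]"
      using assms sym pair_graphD(3)[OF pair_graph_F] by auto
    show "set [a, b, c, d, e] \<subseteq> pverts F"
      using assms pair_graphD(1,2)[OF pair_graph_F] by auto
    show "sorted_wrt (\<lambda>(h, x) (h', x').
        (h, h') \<in> parcs (complete_graph 2 \<oplus>\<^sub>g complete_graph 2 \<oplus>\<^sub>g complete_graph 1) \<longleftrightarrow> x \<sim> x')
        (zip verts_2K2_K1 [a, b, c, d, e])"
      using assms by (simp add: copy_simps adj_sym)
  qed
  with free1 show False by simp
qed

lemma no_D222_K1:
  assumes "distinct [b, d, a1, a2, c1, c2, e]" "{b, d, a1, a2, c1, c2, e} \<subseteq> pverts F"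
    and "b \<sim> d" "b \<sim> a1" "b \<sim> a2" "d \<sim> c1" "d \<sim> c2"
    and "\<not> a1 \<sim> a2" "\<not> c1 \<sim> c2" "\<not> b \<sim> c1" "\<not> b \<sim> c2" "\<not> d \<sim> a1" "\<not> d \<sim> a2"
    and "\<not> a1 \<sim> c1" "\<not> a1 \<sim> c2" "\<not> a2 \<sim> c1" "\<not> a2 \<sim> c2"
    and "\<not> e \<sim> b" "\<not> e \<sim> d" "\<not> e \<sim> a1" "\<not> e \<sim> a2" "\<not> e \<sim> c1" "\<not> e \<sim> c2"
  shows False
proof -
  have "\<not> induced_free F (double_broom 2 2 2 \<oplus>\<^sub>g complete_graph 1)"
  proof (rule not_induced_freeI[OF pair_graph_F pair_graph_patterns(2) verts_D222_K1])
    let ?xs = "[b, d, a1, a2, c1, c2, e]"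
    show "length ?xs = length verts_D222_K1" by (simp add: verts_D222_K1_def)
    show "distinct ?xs" "set ?xs \<subseteq> pverts F" using assms(1,2) by simp_all
    show "sorted_wrt (\<lambda>(h, x) (h', x').
        (h, h') \<in> parcs (double_broom 2 2 2 \<oplus>\<^sub>g complete_graph 1) \<longleftrightarrow> x \<sim> x')
        (zip verts_D222_K1 ?xs)"
      using assms(3-) by (simp add: copy_simps adj_sym)
  qed
  with free2 show False by simp
qed

text \<open>The spine is \<open>h c d a\<close>. The four induced paths, one for each choice of a
  leaf at either end, settle all pairs except the two leaves at a common end; these are settled by
  the forks.\<close>

lemma no_D242:
  assumes "h \<sim> c" "c \<sim> d" "d \<sim> a" "h \<sim> q" "h \<sim> g" "a \<sim> b" "a \<sim> b'"
    and "q \<noteq> g" "b \<noteq> b'" "chordless (parcs F) [q, h, c, d, a, b]"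
    "chordless (parcs F) [q, h, c, d, a, b']" "chordless (parcs F) [g, h, c, d, a, b]"
    "chordless (parcs F) [g, h, c, d, a, b']"
  shows False
proof -
  have sym: "q \<sim> h" "b \<sim> a" using assms(4,6) by (simp_all add: adj_sym)
  have forks: "chordless (parcs F) [q, h, g]" "chordless (parcs F) [b, a, b']"
    by (rule chordless_walk; use assms(1-9) sym in auto)+
  have "\<not> induced_free F (double_broom 2 4 2)"
  proof (rule not_induced_freeI[OF pair_graph_F pair_graph_patterns(3) verts_D242])
    let ?xs = "[h, c, d, a, q, g, b, b']"
    show "length ?xs = length verts_D242" by (simp add: verts_D242_def)
    show "distinct ?xs"
      using assms pair_graphD(3)[OF pair_graph_F] by auto
    show "set ?xs \<subseteq> pverts F"
      using assms(1-7) pair_graphD(1,2)[OF pair_graph_F] by auto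
    show "sorted_wrt (\<lambda>(h, x) (h', x').
        (h, h') \<in> parcs (double_broom 2 4 2) \<longleftrightarrow> x \<sim> x') (zip verts_D242 ?xs)"
      using assms forks by (simp add: copy_simps)
  qed
  with free3 show False by simp
qed

section \<open>Constraints on consecutive moves\<close>

lemma next_move:
  assumes m: "move i x y p q"
  obtains (same) z where "z \<noteq> x" "move (Suc i) y z p q"
  | (first) d where "d \<sim> x" "move (Suc i) p d y q"
  | (second) d where "d \<sim> x" "move (Suc i) q d y p"
proof -
  note mD = moveD[OF m]
  from w_arc[of "Suc i"] obtain u v where uv: "u \<in> {y, p, q}" "v \<notin> {y, p, q}" "u \<sim> v"
    "w (Suc (Suc i)) = insert v ({y, p, q} - {u})"
    "insert v ({y, p, q} - {u}) \<in> pverts (TS 3 F)"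
    unfolding move_sets(2)[OF m] by (elim TS_arcE) auto
  consider "u = y" | "u = p" | "u = q" using uv(1) by blast
  \<comment> \<open>Case \<open>same\<close> is a slide. In the other cases the token on
    \<open>p\<close> or \<open>q\<close> moves to \<open>v\<close>, and \<open>v\<close> must touch
    \<open>x\<close>: otherwise that edge, the edge \<open>xy\<close> and the token still resting
    would induce the excluded \<open>2K_2 + K_1\<close>.\<close>
  then show thesis
  proof cases
    case 1
    then have "w (Suc (Suc i)) = {v, p, q}" using uv(4) mD(3) by auto
    then have "v \<noteq> x" "move (Suc i) y v p q"
      using w_nb[of i] move_sets[OF m] mD 1 uv by (auto simp: move_def)
    then show thesis by (rule same)
  next
    case 2
    then have mv: "move (Suc i) p v y q"
      using move_sets[OF m] mD uv 2 by (auto simp: move_def insert_commute)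
    have "v \<sim> x"
    proof (rule ccontr)
      assume "\<not> v \<sim> x"
      then show False
        using no_2K2_K1[of x y p v q] mD moveD[OF mv] by (auto simp: adj_sym)
    qed
    then show thesis using mv by (rule first)
  next
    case 3
    then have mv: "move (Suc i) q v y p"
      using move_sets[OF m] mD uv 3 by (auto simp: move_def insert_commute)
    have "v \<sim> x"
    proof (rule ccontr)
      assume "\<not> v \<sim> x"
      then show False
        using no_2K2_K1[of x y q v p] mD moveD[OF mv] by (auto simp: adj_sym)
    qed
    then show thesis using mv by (rule second)
  qed
qed

text \<open>If \<open>r\<close> were not adjacent to \<open>q\<close>, then excluding
  \<open>2K_2 + K_1\<close> with isolated vertex \<open>q\<close> would force \<open>r\<close> to be
  adjacent to an end of \<open>ab\<close> and to an end of \<open>de\<close>. Together with the path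
  \<open>a b d e\<close> this closes a cycle.\<close>

lemma triple_slide_neighbour:
  assumes m1: "move i a b p q" and m2: "move (Suc i) b d p q" and m3: "move (Suc (Suc i)) d e p q"
    and "a \<noteq> d" "b \<noteq> e" and r: "p \<sim> r"
  shows "r \<sim> q"
proof (rule ccontr)
  note mD = moveD[OF m1] moveD[OF m2] moveD[OF m3]
  assume nq: "\<not> r \<sim> q"
  have "r \<noteq> a" "r \<noteq> b" "r \<noteq> d" "r \<noteq> e" using r mD by auto
  have "r \<sim> a \<or> r \<sim> b"
    using no_2K2_K1[of a b p r q] r nq mD by (auto simp: adj_sym)
  moreover have "r \<sim> d \<or> r \<sim> e"
    using no_2K2_K1[of d e p r q] r nq mD by (auto simp: adj_sym)
  moreover have False if "r \<sim> b" "r \<sim> d \<or> r \<sim> e"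
  proof -
    have "chordless (parcs F) [r, b, d, e]"
      by (rule chordless_walk) (use that mD \<open>b \<noteq> e\<close> \<open>r \<noteq> d\<close> in auto)
    with that show False by simp
  qed
  moreover have False if "r \<sim> a" "r \<sim> d \<or> r \<sim> e"
  proof -
    have "chordless (parcs F) [r, a, b, d, e]"
      by (rule chordless_walk) (use that mD \<open>a \<noteq> d\<close> \<open>b \<noteq> e\<close> \<open>r \<noteq> b\<close> in auto)
    with that show False by simp
  qed
  ultimately show False by blast
qed

text \<open>Here \<open>p\<close> and \<open>q\<close> have the same neighbours, so neither token
  can ever move while the other rests: its new vertex would be adjacent to the other token. The
  third token then walks forever in the forest \<open>F\<close>.\<close>

lemma no_triple_slide:
  assumes m1: "move i a b p q" and m2: "move (Suc i) b d p q" and m3: "move (Suc (Suc i)) d e p q"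
    and neq: "a \<noteq> d" "b \<noteq> e"
  shows False
proof -
  have pq: "r \<sim> q" if "p \<sim> r" for r
    using triple_slide_neighbour[OF m1 m2 m3 neq that] .
  have qp: "r \<sim> p" if "q \<sim> r" for r
    using triple_slide_neighbour[of i a b q p d e r] m1 m2 m3 neq that move_commute by blast
  have "\<exists>x y. move (i + n) x y p q" for n
  proof (induction n)
    case 0
    then show ?case using m1 by auto
  next
    case (Suc n)
    then obtain x y where m: "move (i + n) x y p q" by blast
    then show ?case
    proof (cases rule: next_move)
      case (first d)
      have False using pq[of d] moveD[OF first(2)] by auto
      then show ?thesis ..
    next
      case (second d)
      have False using qp[of d] moveD[OF second(2)] by auto
      then show ?thesis ..
    qed auto
  qed
  then obtain f g where fg: "\<And>n. move (i + n) (f n) (g n) p q" by metis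
  \<comment> \<open>Successive moves agree on the position of the moving token; so \<open>f\<close>
    is a walk, and it inherits the absence of backtracking from \<open>w\<close>.\<close>
  have g: "g n = f (Suc n)" for n
    using move_sets(2)[OF fg[of n]] move_sets(1)[OF fg[of "Suc n"]]
      moveD(3)[OF fg[of n]] moveD(3)[OF fg[of "Suc n"]]
    by auto
  have "f n \<sim> f (Suc n)" for n using moveD(1)[OF fg[of n]] g by simp
  moreover have "f n \<noteq> f (Suc (Suc n))" for n
    using move_sets(1)[OF fg[of n]] move_sets(1)[OF fg[of "Suc (Suc n)"]] w_nb[of "i + n"] by auto
  ultimately show False
    using forest undirected_forest_iff_no_walk[OF pair_graph_F] by blast
qed

text \<open>The three moves lie along the induced path \<open>q h c d a b\<close>. Up to cycles and
  forbidden subgraphs the continuation is forced: \<open>h\<close> to \<open>g\<close>,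
  \<open>d\<close> to \<open>c\<close>, \<open>b\<close> to \<open>a\<close>, \<open>a\<close> to
  \<open>a'\<close>. Then \<open>q\<close>, \<open>g\<close> at \<open>h\<close> and
  \<open>b\<close>, \<open>a'\<close> at \<open>a\<close> complete \<open>D_{2,4,2}\<close>.\<close>

lemma no_double_follow:
  assumes m0: "move i a b c q" and da: "d \<sim> a" and m1: "move (Suc i) c d b q"
    and hc: "h \<sim> c" and m2: "move (Suc (Suc i)) q h b d"
  shows False
proof -
  note mD = moveD[OF m0] moveD[OF m1] moveD[OF m2]
  have E: "a \<sim> d" "c \<sim> h" "d \<sim> a" "h \<sim> c" using da hc by (auto simp: adj_sym)
  have P1: "chordless (parcs F) [q, h, c, d, a, b]"
    by (rule chordless_walk) (use E mD in auto)
  \<comment> \<open>A follow by the token on \<open>b\<close> or \<open>d\<close> closes a cycle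
    through \<open>q\<close>, so the token on \<open>h\<close> goes on to a new vertex
    \<open>g\<close>.\<close>
  from m2 show False
  proof (cases rule: next_move)
    case (first y)
    have "y \<sim> b" using moveD[OF first(2)] by simp
    have "chordless (parcs F) [y, q, h, c, d, a, b]"
      by (rule chordless_walk) (use E mD moveD[OF first(2)] first(1) P1 in auto)
    with \<open>y \<sim> b\<close> show False by simp
  next
    case (second y)
    have "y \<sim> d" using moveD[OF second(2)] by simp
    have "chordless (parcs F) [y, q, h, c, d]"
      by (rule chordless_walk) (use E mD moveD[OF second(2)] second(1) P1 in auto)
    with \<open>y \<sim> d\<close> show False by simp
  next
    case (same g)
    note m3 = same(2) and gD = moveD[OF same(2)]
    have P2: "chordless (parcs F) [g, h, c, d, a, b]"
      by (rule chordless_walk) (use E mD gD in auto)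
    \<comment> \<open>Going on from \<open>g\<close> would be a triple slide, and a follow from
      \<open>b\<close> closes a cycle. The token on \<open>d\<close> can only go to
      \<open>c\<close>, since another common neighbour of \<open>h\<close> and \<open>d\<close>
      would give a 4-cycle.\<close>
    have m4: "move (Suc (Suc (Suc (Suc i)))) d c g b"
      using m3
    proof (cases rule: next_move)
      case (same z)
      then show ?thesis using no_triple_slide[OF m2 m3 same(2)] \<open>g \<noteq> q\<close> by blast
    next
      case (first y)
      note yD = moveD[OF first(2)]
      have "y \<noteq> c" using yD P1 by auto
      have "chordless (parcs F) [y, h, c, d, a, b]"
        by (rule chordless_walk) (use E mD yD first(1) P1 \<open>y \<noteq> c\<close> in auto)
      with yD have False by simp
      then show ?thesis ..
    next
      case (second y)
      note yD = moveD[OF second(2)]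
      have "y = c"
      proof (rule ccontr)
        assume "y \<noteq> c"
        have "chordless (parcs F) [y, h, c, d]"
          by (rule chordless_walk) (use E mD yD second(1) P1 \<open>y \<noteq> c\<close> in auto)
        with yD show False by simp
      qed
      then show ?thesis using second by simp
    qed
    \<comment> \<open>If the token on \<open>c\<close> went on to \<open>z\<close>, then
      \<open>hq\<close>, \<open>ab\<close> and \<open>z\<close> would induce
      \<open>2K_2 + K_1\<close>. A follow from \<open>g\<close> closes a cycle, and one from
      \<open>b\<close> must go to \<open>a\<close>, again to avoid a 4-cycle.\<close>
    have m5: "move (Suc (Suc (Suc (Suc (Suc i))))) b a c g"
      using m4
    proof (cases rule: next_move)
      case (same z)
      note zD = moveD[OF same(2)]
      have "z \<noteq> h" using zD gD by auto
      have "chordless (parcs F) [z, c, h, q]"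
        by (rule chordless_walk) (use E mD zD \<open>z \<noteq> h\<close> in auto)
      moreover have "chordless (parcs F) [z, c, d, a, b]"
        by (rule chordless_walk) (use E mD zD \<open>z \<noteq> d\<close> in auto)
      ultimately have False
        using no_2K2_K1[of h q a b z] P1 E mD zD by auto
      then show ?thesis ..
    next
      case (first y)
      note yD = moveD[OF first(2)]
      have "chordless (parcs F) [y, d, c, h, g]"
        by (rule chordless_walk) (use E mD gD yD first(1) P1 P2 in auto)
      with yD have False by simp
      then show ?thesis ..
    next
      case (second y)
      note yD = moveD[OF second(2)]
      have "y = a"
      proof (rule ccontr)
        assume "y \<noteq> a"
        have "chordless (parcs F) [y, d, a, b]"
          by (rule chordless_walk) (use E mD yD second(1) P1 \<open>y \<noteq> a\<close> in auto)
        with yD show False by simp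
      qed
      then show ?thesis using second by simp
    qed
    from m5 show False
    proof (cases rule: next_move)
      case (same a')
      note aD = moveD[OF same(2)]
      \<comment> \<open>The token on \<open>c\<close> rests during this move and \<open>c\<close> is
        adjacent to \<open>d\<close>, so \<open>d\<close> cannot be the target.\<close>
      have "a' \<noteq> d" using aD mD by auto
      have P3: "chordless (parcs F) [q, h, c, d, a, a']" "chordless (parcs F) [g, h, c, d, a, a']"
        by (rule chordless_walk; use E mD gD aD \<open>a' \<noteq> d\<close> P1 P2 in auto)+
      show False
        by (rule no_D242[OF _ _ _ _ _ _ _ _ _ P1 P3(1) P2 P3(2)])
          (use E mD gD aD same(1) \<open>g \<noteq> q\<close> in auto)
    next
      case (first y)
      note yD = moveD[OF first(2)]
      have "chordless (parcs F) [y, b, a, d, c]"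
        by (rule chordless_walk) (use E mD yD first(1) P1 in \<open>auto simp: adj_sym\<close>)
      with yD show False by simp
    next
      case (second y)
      note yD = moveD[OF second(2)]
      have "chordless (parcs F) [y, b, a, d, c, h, g]"
        by (rule chordless_walk) (use E mD gD yD second(1) P1 P2 in \<open>auto simp: adj_sym\<close>)
      with yD show False by simp
    qed
  qed
qed

text \<open>A second follow is impossible: by the token on \<open>b\<close> it would close the cycle
  \<open>b a d c h\<close>, and by the token on \<open>q\<close> it is excluded by
  \<open>no_double_follow\<close>.\<close>

lemma follow_then_slide:
  assumes m0: "move i a b c q" and da: "d \<sim> a" and m1: "move (Suc i) c d b q"
  obtains z where "z \<noteq> c" "move (Suc (Suc i)) d z b q"
  using m1
proof (cases rule: next_move)
  case (same z)
  then show thesis by (rule that)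
next
  case (first h)
  note mD = moveD[OF first(2)] moveD[OF m0] moveD[OF m1]
  have "chordless (parcs F) [b, a, d, c, h]"
    by (rule chordless_walk) (use da mD first(1) in \<open>auto simp: adj_sym\<close>)
  with mD show thesis by simp
next
  case (second h)
  then show thesis using no_double_follow[OF m0 da m1 second(1)] move_commute by blast
qed

text \<open>The follow continues with a slide from \<open>d\<close> to some \<open>f\<close>. The
  edge \<open>bd\<close> with leaves \<open>a\<close>, \<open>e\<close> at \<open>b\<close> and
  \<open>p\<close>, \<open>f\<close> at \<open>d\<close>, together with the token on
  \<open>q\<close>, which rests throughout, gives \<open>D_{2,2,2} + K_1\<close>.\<close>

lemma no_slide_follow:
  assumes m0: "move i a b p q" and m1: "move (Suc i) b e p q" and "a \<noteq> e"
    and db: "d \<sim> b" and m2: "move (Suc (Suc i)) p d e q"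
  shows False
proof -
  obtain f where "f \<noteq> p" and m3: "move (Suc (Suc (Suc i))) d f e q"
    using follow_then_slide[OF m1 db m2] .
  note fD = moveD[OF m3]
  note mD = moveD[OF m0] moveD[OF m1] moveD[OF m2]
  have bd: "b \<sim> d" "d \<sim> b" using db by (auto simp: adj_sym)
  \<comment> \<open>\<open>d\<close> is adjacent to \<open>p\<close> but \<open>a\<close> is not;
    \<open>b\<close> is adjacent to \<open>e\<close> but \<open>f\<close> is not.\<close>
  have neq: "a \<noteq> d" "f \<noteq> b" using mD fD by auto
  have "chordless (parcs F) [a, b, d, p]" "chordless (parcs F) [a, b, d, f]"
    "chordless (parcs F) [a, b, e]" "chordless (parcs F) [p, d, f]"
    by (rule chordless_walk; use bd mD fD neq \<open>a \<noteq> e\<close> \<open>f \<noteq> p\<close> in auto)+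
  then show False
    using no_D222_K1[of b d a e p f q] bd mD fD neq \<open>a \<noteq> e\<close> \<open>f \<noteq> p\<close> by auto
qed

lemma no_slide:
  assumes m0: "move i a b p q" and m1: "move (Suc i) b e p q" and "a \<noteq> e"
  shows False
  using m1
proof (cases rule: next_move)
  case (same f)
  then show False using no_triple_slide[OF m0 m1 same(2)] \<open>a \<noteq> e\<close> by blast
next
  case (first d)
  then show False using no_slide_follow[OF m0 m1 \<open>a \<noteq> e\<close>] by blast
next
  case (second d)
  then show False using no_slide_follow[of i a b q p e d] m0 m1 \<open>a \<noteq> e\<close> move_commute by blast
qed

lemma contradiction: False
proof -
  obtain x y p q where m0: "move 0 x y p q"
  proof -
    obtain u v where uv: "w 0 \<in> pverts (TS 3 F)" "u \<in> w 0" "v \<notin> w 0" "u \<sim> v"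
      "w (Suc 0) = insert v (w 0 - {u})"
      using TS_arcE[OF w_arc[of 0]] by metis
    then have "card (w 0 - {u}) = 2" by (simp add: TS_def Let_def)
    then obtain p q where "w 0 - {u} = {p, q}" "p \<noteq> q" by (auto simp: card_2_iff)
    moreover from this have "w 0 = {u, p, q}" "u \<noteq> p" "u \<noteq> q" using uv(2) by auto
    ultimately have "move 0 u v p q" using uv by (auto simp: move_def)
    then show thesis by (rule that)
  qed
  \<comment> \<open>The token that follows must slide on in the next move, and
    \<open>no_slide\<close> forbids this. Hence the first move has no possible successor.\<close>
  have no_follow: False if mv: "move i a b c q" and da: "d \<sim> a" and mv': "move (Suc i) c d b q"
    for i a b c q d
    using follow_then_slide[OF mv da mv'] no_slide[OF mv'] by metis
  from m0 show False
  proof (cases rule: next_move)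
    case (same z)
    then show False using no_slide[OF m0 same(2)] by blast
  next
    case (first d)
    then show False using no_follow[OF m0] by blast
  next
    case (second d)
    then show False using no_follow[of 0 x y q p d] m0 move_commute by blast
  qed
qed

end

theorem corollary7:
  fixes F :: "'a pair_pre_digraph"
  assumes "undirected_forest F"
  shows "undirected_forest (TS 3 F) \<longleftrightarrow>
    induced_free F (complete_graph 2 \<oplus>\<^sub>g complete_graph 2 \<oplus>\<^sub>g complete_graph 1) \<and>
    induced_free F (double_broom 2 2 2 \<oplus>\<^sub>g complete_graph 1) \<and>
    induced_free F (double_broom 2 4 2)"
    (is "?forest \<longleftrightarrow> ?free")
proof
  have F: "pair_graph F" using assms by (simp add: undirected_forest_def)
  show ?free if ?forest
    using that forest_TS3_imp_no_2K2_K1[OF F] forest_TS3_imp_no_D222_K1[OF F]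
      forest_TS3_imp_no_D242[OF F] by simp
  show ?forest if ?free
  proof (rule ccontr)
    assume "\<not> ?forest"
    then obtain w where "\<And>i. (w i, w (Suc i)) \<in> parcs (TS 3 F)" "\<And>i. w i \<noteq> w (Suc (Suc i))"
      unfolding undirected_forest_iff_no_walk[OF pair_graph_TS[OF F]] by blast
    then have "sliding_walk F w" using assms \<open>?free\<close> by unfold_locales simp_all
    then show False by (rule sliding_walk.contradiction)
  qed
qed

end
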